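(* Let $L\subseteq E$ be a linear subspace such that $L\cap\operatorname{int}(K)\neq\emptyset$. Then $$\left(\min_{\substack{u\in K^*\\ \|u\|^*=1}}\ \max_{\substack{v\in K\\ \|v\|=1}}\langle u,v\rangle\right)\cdot\frac{\operatorname{Sym}(L,K)}{1+\operatorname{Sym}(L,K)}\le\nu(L)\le\frac{\operatorname{Sym}(L,K)}{1-\operatorname{Sym}(L,K)}.$$ In particular, if $\|\cdot\|=\|\cdot\|_2$ then $$\cos(\Theta(K^*,K))\cdot\frac{\operatorname{Sym}(L,K)}{1+\operatorname{Sym}(L,K)}\le\nu(L)\le\frac{\operatorname{Sym}(L,K)}{1-\operatorname{Sym}(L,K)}.$$ Here the right-most expressions are understood as $+\infty$ if $\operatorname{Sym}(L,K)=1$.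
   Context: $E$ is a finite-dimensional real vector space with inner product $\langle\cdot,\cdot\rangle$, endowed with a norm $\|\cdot\|$ (possibly non-Euclidean); the dual norm is $\|u\|^*:=\max_{\|x\|=1}\langle u,x\rangle$. $\|v\|_2:=\sqrt{\langle v,v\rangle}$, and for nonzero $x,y\in E$, $\angle(x,y):=\arccos\frac{\langle x,y\rangle}{\|x\|_2\|y\|_2}\in[0,\pi]$. $K\subseteq E$ is a regular closed convex cone ($\operatorname{int}(K)\neq\emptyset$ and $K$ contains no lines), with dual cone $K^*:=\{u\in E:\langle u,x\rangle\ge 0\ \forall x\in K\}$, and $$\Theta(K^*,K):=\max_{u\in K^*\setminus\{0\}}\ \min_{v\in K\setminus\{0\}}\angle(u,v).$$ For a linear subspace $L\subseteq E$ with orthogonal complement $L^\perp$, $$\nu(L):=\min_{u\in K^*,\,y\in L^\perp,\,\|u\|^*=1}\|u-y\|^*,$$ $$\operatorname{Sym}(L,K):=\min_{v\in K,\,\|v\|\le 1}\ \max_{x\in K,\,\|x\|\le 1}\{t\ge 0: x+tv\in L\},$$ where, for each $v$, the inner maximum is the largest $t\ge 0$ such that $x+tv\in L$ for some $x\in K$ with $\|x\|\le 1$ (equal to $+\infty$ if such $t$ are unbounded, which happens when $v\in L$). *)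

theory Defs
  imports "HOL-Analysis.Analysis"
begin

text \<open>
  The type class \<open>euclidean_space\<close> carries the inner product \<open>\<bullet>\<close> and its Euclidean norm
  \<open>norm\<close>.  The second, possibly non-Euclidean, norm is a function \<open>N\<close>; as all norms are
  equivalent in finite dimension, \<open>interior\<close> and \<open>closed\<close> do not depend on the choice of norm.

  Minima and maxima are written as infima and suprema.  For a norm \<open>N\<close>, a regular closed convex
  cone \<open>K\<close> and a subspace \<open>L\<close> that meets \<open>interior K\<close>, all index sets below are nonempty, all
  real-valued families are bounded, and all extrema are attained, except that in \<open>Sym\<close> the inner
  supremum is \<open>\<infinity>\<close> if \<open>v \<in> L\<close>.
\<close>

definition is_norm :: "('a::real_vector \<Rightarrow> real) \<Rightarrow> bool" where
  "is_norm N \<longleftrightarrow>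
     (\<forall>x. N x = 0 \<longleftrightarrow> x = 0) \<and>
     (\<forall>c x. N (c *\<^sub>R x) = \<bar>c\<bar> * N x) \<and>
     (\<forall>x y. N (x + y) \<le> N x + N y)"

definition dual_norm :: "('a::euclidean_space \<Rightarrow> real) \<Rightarrow> 'a \<Rightarrow> real" where
  "dual_norm N u = (SUP x\<in>{x. N x = 1}. u \<bullet> x)"

definition vec_angle :: "'a::euclidean_space \<Rightarrow> 'a \<Rightarrow> real" where
  "vec_angle x y = arccos (x \<bullet> y / (norm x * norm y))"

definition regular_closed_convex_cone :: "'a::euclidean_space set \<Rightarrow> bool" where
  "regular_closed_convex_cone K \<longleftrightarrow>
     closed K \<and> convex_cone K \<and> interior K \<noteq> {} \<and>
     \<not> (\<exists>x d. d \<noteq> 0 \<and> (\<forall>t::real. x + t *\<^sub>R d \<in> K))"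

definition dual_cone :: "'a::euclidean_space set \<Rightarrow> 'a set" where
  "dual_cone K = {u. \<forall>x\<in>K. u \<bullet> x \<ge> 0}"

definition Theta :: "'a::euclidean_space set \<Rightarrow> 'a set \<Rightarrow> real" where
  "Theta C K = (SUP u\<in>C - {0}. INF v\<in>K - {0}. vec_angle u v)"

definition nu :: "('a::euclidean_space \<Rightarrow> real) \<Rightarrow> 'a set \<Rightarrow> 'a set \<Rightarrow> real" where
  "nu N K L =
     (INF (u, y)\<in>{u \<in> dual_cone K. dual_norm N u = 1} \<times> (L\<^sup>\<bottom>). dual_norm N (u - y))"

definition Sym :: "('a::euclidean_space \<Rightarrow> real) \<Rightarrow> 'a set \<Rightarrow> 'a set \<Rightarrow> ereal" where
  "Sym N L K =
     (INF v\<in>{v \<in> K. N v \<le> 1}.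
        SUP t\<in>{t::real. t \<ge> 0 \<and> (\<exists>x\<in>K. N x \<le> 1 \<and> x + t *\<^sub>R v \<in> L)}. ereal t)"

text \<open>
  The quotients \<open>s / (1 + s)\<close> and \<open>s / (1 - s)\<close>.  If \<open>L\<close> is a proper subspace then
  \<open>Sym N L K \<le> 1\<close>, and the only convention that matters is the value \<open>\<infinity>\<close> of \<open>s / (1 - s)\<close> at
  \<open>s = 1\<close>.  If \<open>L\<close> is the whole space then \<open>Sym N L K = \<infinity>\<close>; the first quotient is then read as its
  limit \<open>1\<close> (\<open>ereal\<close> division would give \<open>\<infinity> / \<infinity> = 0\<close>) and the second one as \<open>\<infinity>\<close>.
\<close>

definition sym_lower :: "ereal \<Rightarrow> ereal" where
  "sym_lower s = (if s = \<infinity> then 1 else s / (1 + s))"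

definition sym_upper :: "ereal \<Rightarrow> ereal" where
  "sym_upper s = (if s = 1 \<or> s = \<infinity> then \<infinity> else s / (1 - s))"

definition min_max_inner :: "('a::euclidean_space \<Rightarrow> real) \<Rightarrow> 'a set \<Rightarrow> real" where
  "min_max_inner N K =
     (INF u\<in>{u \<in> dual_cone K. dual_norm N u = 1}. SUP v\<in>{v \<in> K. N v = 1}. u \<bullet> v)"

end

theory Submission
  imports Defs
begin

text \<open>
  Lower bound: if \<open>u \<in> K\<^sup>*\<close> has dual norm 1, \<open>y \<bottom> L\<close>, \<open>v\<close> maximizes \<open>u\<close> on the unit sphere of \<open>K\<close>
  and \<open>x + t v \<in> L\<close>, then \<open>t (u \<bullet> v) \<le> u \<bullet> (x + t v) = (u - y) \<bullet> (x + t v) \<le> \<parallel>u - y\<parallel>\<^sup>* (1 + t)\<close>.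
  Upper bound: if \<open>x + t v \<notin> L\<close> for all \<open>x\<close> in the unit ball of \<open>K\<close>, a hyperplane separating this
  translated ball from \<open>L\<close> gives \<open>w \<bottom> L\<close> with \<open>w \<bullet> x \<ge> - t (w \<bullet> v)\<close> on the ball; hence some
  \<open>u \<in> K\<^sup>*\<close> is within dual distance \<open>t (w \<bullet> v)\<close> of \<open>w\<close>, while \<open>\<parallel>u\<parallel>\<^sup>* \<ge> u \<bullet> v \<ge> (1 - t) (w \<bullet> v)\<close>.
\<close>

section \<open>Arbitrary norms on a Euclidean space: continuity and compact balls\<close>

lemma is_norm_scaleR: "is_norm N \<Longrightarrow> N (c *\<^sub>R x) = \<bar>c\<bar> * N x"
  and is_norm_triangle: "is_norm N \<Longrightarrow> N (x + y) \<le> N x + N y"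
  and is_norm_eq_0_iff: "is_norm N \<Longrightarrow> N x = 0 \<longleftrightarrow> x = 0"
  by (auto simp: is_norm_def)

lemma is_norm_0: "is_norm N \<Longrightarrow> N 0 = 0"
  by (simp add: is_norm_eq_0_iff)

lemma is_norm_minus: "is_norm N \<Longrightarrow> N (- x) = N x"
  using is_norm_scaleR[of N "-1" x] by simp

lemma is_norm_nonneg: "is_norm N \<Longrightarrow> 0 \<le> N x"
  using is_norm_triangle[of N x "- x"] is_norm_0[of N] by (simp add: is_norm_minus)

lemma is_norm_pos: "is_norm N \<Longrightarrow> x \<noteq> 0 \<Longrightarrow> 0 < N x"
  using is_norm_nonneg is_norm_eq_0_iff by (metis less_eq_real_def)

lemma is_norm_normalize: "is_norm N \<Longrightarrow> x \<noteq> 0 \<Longrightarrow> N (inverse (N x) *\<^sub>R x) = 1"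
  using is_norm_pos[of N x] by (simp add: is_norm_scaleR)

lemma is_norm_convex_on:
  assumes "is_norm N"
  shows "convex_on UNIV N"
proof (rule convex_onI)
  fix t :: real and x y
  assume "0 < t" "t < 1"
  then show "N ((1 - t) *\<^sub>R x + t *\<^sub>R y) \<le> (1 - t) * N x + t * N y"
    using is_norm_triangle[OF assms, of "(1 - t) *\<^sub>R x" "t *\<^sub>R y"]
    by (simp add: is_norm_scaleR[OF assms])
qed simp

lemma is_norm_continuous_on:
  fixes N :: "'a::euclidean_space \<Rightarrow> real"
  assumes "is_norm N"
  shows "continuous_on S N"
  using convex_on_continuous[OF open_UNIV is_norm_convex_on[OF assms]] continuous_on_subset by blast

text \<open>Compactness of the Euclidean unit sphere gives a point where \<open>N\<close> is least;
  the value there is positive by definiteness, and homogeneity carries the bound to all vectors.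
  This is the half of norm equivalence that makes \<open>N\<close>-balls bounded.\<close>

lemma is_norm_lower_bound:
  fixes N :: "'a::euclidean_space \<Rightarrow> real"
  assumes "is_norm N"
  obtains m where "0 < m" "\<And>x. m * norm x \<le> N x"
proof -
  have "\<exists>z\<in>sphere (0::'a) 1. \<forall>x\<in>sphere 0 1. N z \<le> N x"
    by (rule continuous_attains_inf) (auto intro: is_norm_continuous_on[OF assms])
  then obtain z where z: "norm z = 1" "\<And>x. norm x = 1 \<Longrightarrow> N z \<le> N x"
    by auto
  have "N z * norm x \<le> N x" for x
  proof (cases "x = 0")
    case False
    then have "N z \<le> N (inverse (norm x) *\<^sub>R x)"
      by (intro z) simp
    also have "\<dots> = N x / norm x"
      by (simp add: is_norm_scaleR[OF assms] field_simps)
    finally show ?thesis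
      using False by (simp add: field_simps)
  qed (simp add: is_norm_nonneg[OF assms])
  moreover have "0 < N z"
    using z(1) by (intro is_norm_pos[OF assms]) auto
  ultimately show ?thesis using that by blast
qed

text \<open>The centre is kept general because both the unit ball of \<open>N\<close> and dual-norm
  balls around a functional are needed later; centre 0 then appears as \<open>x - 0\<close>.\<close>

lemma is_norm_ball_compact:
  fixes N :: "'a::euclidean_space \<Rightarrow> real"
  assumes "is_norm N"
  shows "compact {x. N (x - w) \<le> r}"
proof -
  obtain m where m: "0 < m" "\<And>x. m * norm x \<le> N x"
    using is_norm_lower_bound[OF assms] by metis
  have "norm (w - x) \<le> r / m" if "N (x - w) \<le> r" for x
    using m(2)[of "x - w"] that m(1) by (simp add: field_simps norm_minus_commute)
  then have "{x. N (x - w) \<le> r} \<subseteq> cball w (r / m)"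
    by (auto simp: dist_norm)
  then have "bounded {x. N (x - w) \<le> r}"
    using bounded_subset by blast
  moreover have "continuous_on UNIV (\<lambda>x. N (x - w))"
    by (intro continuous_on_compose2[OF is_norm_continuous_on[OF assms, of UNIV]] continuous_intros) auto
  then have "closed {x. N (x - w) \<le> r}"
    by (intro closed_Collect_le continuous_intros)
  ultimately show ?thesis
    by (simp add: compact_eq_bounded_closed)
qed

lemma is_norm_ball_convex:
  assumes "is_norm N"
  shows "convex {x. N (x - w) \<le> r}"
proof (rule convexI)
  fix x y and u v :: real
  assume xy: "x \<in> {x. N (x - w) \<le> r}" "y \<in> {x. N (x - w) \<le> r}" and uv: "0 \<le> u" "0 \<le> v" "u + v = 1"
  have "u *\<^sub>R x + v *\<^sub>R y - w = u *\<^sub>R (x - w) + v *\<^sub>R (y - w)"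
    using uv(3) by (simp add: algebra_simps flip: scaleR_left_distrib)
  then have "N (u *\<^sub>R x + v *\<^sub>R y - w) \<le> u * N (x - w) + v * N (y - w)"
    using is_norm_triangle[OF assms, of "u *\<^sub>R (x - w)" "v *\<^sub>R (y - w)"] uv by (simp add: is_norm_scaleR[OF assms])
  also have "\<dots> \<le> u * r + v * r"
    using xy uv by (intro add_mono mult_left_mono) auto
  finally show "u *\<^sub>R x + v *\<^sub>R y \<in> {x. N (x - w) \<le> r}"
    using uv(3) by (simp flip: distrib_right)
qed

lemma is_norm_norm: "is_norm norm"
  by (auto simp: is_norm_def norm_triangle_ineq)

section \<open>The dual norm and norming functionals\<close>

lemma inner_le_dual_norm:
  fixes N :: "'a::euclidean_space \<Rightarrow> real"
  assumes "is_norm N"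
  shows "u \<bullet> x \<le> dual_norm N u * N x"
proof (cases "x = 0")
  case False
  obtain m where m: "0 < m" "\<And>x. m * norm x \<le> N x"
    using is_norm_lower_bound[OF assms] by metis
  \<comment> \<open>The unit sphere of \<open>N\<close> lies in a Euclidean ball of radius
    \<open>1 / m\<close>, so the supremum in \<open>dual_norm\<close> is taken over a bounded set
    and really dominates its members.\<close>
  have "u \<bullet> z \<le> norm u * (1 / m)" if "N z = 1" for z
  proof -
    have "norm z \<le> 1 / m"
      using m(2)[of z] that m(1) by (simp add: field_simps)
    then have "norm u * norm z \<le> norm u * (1 / m)"
      by (intro mult_left_mono) auto
    then show ?thesis
      using norm_cauchy_schwarz[of u z] by linarith
  qed
  then have "bdd_above ((\<lambda>x. u \<bullet> x) ` {x. N x = 1})"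
    by (intro bdd_aboveI2[where M = "norm u * (1 / m)"]) auto
  then have "u \<bullet> (inverse (N x) *\<^sub>R x) \<le> dual_norm N u"
    unfolding dual_norm_def
    by (intro cSUP_upper) (simp_all add: is_norm_normalize[OF assms False])
  then show ?thesis
    using is_norm_pos[OF assms False] by (simp add: field_simps)
qed (simp add: is_norm_0[OF assms])

text \<open>With \<open>inner_le_dual_norm\<close> this characterizes \<open>dual_norm N u\<close>
  as the least admissible constant; later facts about dual norms rest on these two bounds instead of
  the supremum.\<close>

lemma dual_norm_le:
  fixes N :: "'a::euclidean_space \<Rightarrow> real"
  assumes "is_norm N" "\<And>x. u \<bullet> x \<le> c * N x"
  shows "dual_norm N u \<le> c"
proof -
  obtain b :: 'a where "b \<noteq> 0"
    using nonzero_Basis nonempty_Basis by blast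
  then have "{x. N x = 1} \<noteq> {}"
    using is_norm_normalize[OF assms(1)] by blast
  then show ?thesis
    unfolding dual_norm_def by (rule cSUP_least) (use assms(2) in \<open>metis mem_Collect_eq mult.right_neutral\<close>)
qed

lemma dual_norm_nonneg:
  fixes N :: "'a::euclidean_space \<Rightarrow> real"
  assumes "is_norm N"
  shows "0 \<le> dual_norm N u"
proof -
  obtain b :: 'a where "b \<noteq> 0"
    using nonzero_Basis nonempty_Basis by blast
  then have "0 < N b"
    by (rule is_norm_pos[OF assms])
  moreover have "0 \<le> dual_norm N u * N b"
    \<comment> \<open>Adding the bounds at \<open>b\<close> and \<open>- b\<close> cancels the inner
      products.\<close>
    using inner_le_dual_norm[OF assms, of u b] inner_le_dual_norm[OF assms, of u "- b"]
    by (simp add: is_norm_minus[OF assms] del: zero_le_mult_iff)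
  ultimately show ?thesis
    by (simp add: zero_le_mult_iff)
qed

lemma is_norm_dual_norm:
  fixes N :: "'a::euclidean_space \<Rightarrow> real"
  assumes "is_norm N"
  shows "is_norm (dual_norm N)"
proof -
  have zero: "dual_norm N u = 0 \<longleftrightarrow> u = 0" for u
  proof
    show "u = 0" if "dual_norm N u = 0"
      using inner_le_dual_norm[OF assms, of u u] that by (metis inner_gt_zero_iff mult_zero_left not_less)
    show "dual_norm N u = 0" if "u = 0"
      using dual_norm_le[OF assms, of u 0] dual_norm_nonneg[OF assms, of u] that by simp
  qed
  have scale_le: "dual_norm N (c *\<^sub>R u) \<le> \<bar>c\<bar> * dual_norm N u" for c u
  proof (rule dual_norm_le[OF assms])
    fix x
    have "c *\<^sub>R u \<bullet> x = \<bar>c\<bar> * (u \<bullet> (sgn c *\<^sub>R x))"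
      by (simp add: sgn_if)
    also have "\<dots> \<le> \<bar>c\<bar> * (dual_norm N u * N (sgn c *\<^sub>R x))"
      by (intro mult_left_mono inner_le_dual_norm[OF assms]) simp
    also have "\<dots> = \<bar>c\<bar> * dual_norm N u * N x"
      by (cases "c = 0") (simp_all add: is_norm_scaleR[OF assms] abs_sgn_eq)
    finally show "c *\<^sub>R u \<bullet> x \<le> \<bar>c\<bar> * dual_norm N u * N x" .
  qed
  \<comment> \<open>The reverse inequality is \<open>scale_le\<close> for the factor
    \<open>inverse c\<close>.\<close>
  have scale: "dual_norm N (c *\<^sub>R u) = \<bar>c\<bar> * dual_norm N u" for c u
  proof (cases "c = 0")
    case False
    then have "dual_norm N u \<le> \<bar>inverse c\<bar> * dual_norm N (c *\<^sub>R u)"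
      using scale_le[of "inverse c" "c *\<^sub>R u"] by simp
    then have "\<bar>c\<bar> * dual_norm N u \<le> dual_norm N (c *\<^sub>R u)"
      using False by (simp add: field_simps)
    then show ?thesis
      using scale_le[of c u] by simp
  qed (simp add: zero)
  have "dual_norm N (u + v) \<le> dual_norm N u + dual_norm N v" for u v
    using inner_le_dual_norm[OF assms]
    by (intro dual_norm_le[OF assms]) (simp add: inner_add_left distrib_right add_mono)
  with zero scale show ?thesis
    by (auto simp: is_norm_def)
qed

lemma dual_norm_norm: "dual_norm norm u = norm (u :: 'a::euclidean_space)"
proof (rule antisym)
  show "dual_norm norm u \<le> norm u"
    by (intro dual_norm_le is_norm_norm norm_cauchy_schwarz)
  show "norm u \<le> dual_norm norm u"
    using inner_le_dual_norm[OF is_norm_norm, of u u]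
    by (cases "u = 0") (auto simp: dual_norm_nonneg[OF is_norm_norm] dot_square_norm power2_eq_square)
qed

text \<open>Hahn-Banach in finite dimension: a hyperplane separating \<open>z\<close> from the open
  \<open>N\<close>-ball of radius \<open>N z\<close> supports that ball at \<open>z\<close>, and its
  rescaled normal is the functional.\<close>

lemma norming_functional:
  fixes N :: "'a::euclidean_space \<Rightarrow> real"
  assumes "is_norm N" "z \<noteq> 0"
  obtains g where "dual_norm N g \<le> 1" "g \<bullet> z = N z"
proof -
  have Nz: "0 < N z"
    using is_norm_pos[OF assms] .
  have "convex {x. N x < N z}"
  proof (rule convexI)
    fix x y and u v :: real
    assume "x \<in> {x. N x < N z}" "y \<in> {x. N x < N z}" and uv: "0 \<le> u" "0 \<le> v" "u + v = 1"
    then have "u * N x + v * N y < N z"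
      by (intro convex_bound_lt) auto
    then show "u *\<^sub>R x + v *\<^sub>R y \<in> {x. N x < N z}"
      using is_norm_convex_on[OF assms(1)] uv unfolding convex_on_def
      by (metis UNIV_I mem_Collect_eq order_le_less_trans)
  qed
  then obtain a b where ab: "a \<noteq> 0" "\<And>x. N x < N z \<Longrightarrow> a \<bullet> x \<le> b" "b \<le> a \<bullet> z"
    using separating_hyperplane_sets[of "{x. N x < N z}" "{z}"] is_norm_0[OF assms(1)] Nz
    by fastforce
  have le: "(a \<bullet> x) * N z \<le> (a \<bullet> z) * N x" for x
  proof (cases "x = 0")
    case False
    then have Nx: "0 < N x"
      by (rule is_norm_pos[OF assms(1)])
    \<comment> \<open>Here \<open>x\<close> is rescaled to length \<open>s * N z\<close>, strictly
      inside the open ball; afterwards \<open>s\<close> tends to 1.\<close>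
    have *: "s * ((N z / N x) * (a \<bullet> x)) \<le> a \<bullet> z" if "0 < s" "s < 1" for s
      using ab(2)[of "(s * N z / N x) *\<^sub>R x"] ab(3) that Nx Nz
      by (simp add: is_norm_scaleR[OF assms(1)])
    have "(N z / N x) * (a \<bullet> x) \<le> a \<bullet> z"
      by (rule field_le_mult_one_interval) (use * in auto)
    then show ?thesis
      using Nx by (simp add: field_simps)
  qed (simp add: is_norm_0[OF assms(1)])
  \<comment> \<open>The choice \<open>x = a\<close> in \<open>le\<close> shows that
    \<open>a \<bullet> z\<close> is positive and may be divided by.\<close>
  have "0 < (a \<bullet> z) * N a"
    using le[of a] Nz ab(1) by (smt (verit) inner_gt_zero_iff mult_pos_pos)
  then have az: "0 < a \<bullet> z"
    using is_norm_nonneg[OF assms(1), of a] by (simp add: zero_less_mult_iff)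
  define g where "g = (N z / (a \<bullet> z)) *\<^sub>R a"
  have "dual_norm N g \<le> 1"
    using le az by (intro dual_norm_le[OF assms(1)]) (simp add: g_def field_simps)
  moreover have "g \<bullet> z = N z"
    using az by (simp add: g_def)
  ultimately show ?thesis
    using that by blast
qed

section \<open>Dual cones and separation\<close>

lemma convex_cone_dual_cone: "convex_cone (dual_cone K)"
  by (auto simp: convex_cone_iff dual_cone_def inner_add_left)

lemma closed_dual_cone: "closed (dual_cone K)"
proof -
  have "dual_cone K = (\<Inter>x\<in>K. {u. 0 \<le> x \<bullet> u})"
    by (auto simp: dual_cone_def inner_commute)
  then show ?thesis
    by (auto intro!: closed_INT closed_halfspace_ge)
qed

text \<open>One half of the bipolar theorem: a functional bounded below on a cone is nonnegative
  there, so a strictly separating hyperplane can be moved to the origin.\<close>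

lemma separating_dual_cone:
  fixes K :: "'a::euclidean_space set"
  assumes "closed K" "convex_cone K" "z \<notin> K"
  obtains u where "u \<in> dual_cone K" "u \<bullet> z < 0"
proof -
  obtain a b where ab: "a \<bullet> z < b" "\<And>x. x \<in> K \<Longrightarrow> b < a \<bullet> x"
    using separating_hyperplane_closed_point assms unfolding convex_cone_def by metis
  have b: "b < 0"
    using ab(2)[OF convex_cone_contains_0[OF assms(2)]] by simp
  have "0 \<le> a \<bullet> x" if "x \<in> K" for x
  proof (rule ccontr)
    assume "\<not> 0 \<le> a \<bullet> x"
    then have neg: "a \<bullet> x < 0"
      by simp
    \<comment> \<open>This multiple stays in the cone and gives \<open>a\<close> exactly the value
      \<open>b\<close>, against strict separation.\<close>
    then have "(b / (a \<bullet> x)) *\<^sub>R x \<in> K"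
      using b by (intro convex_cone_scaleR[OF assms(2)] that) (simp add: divide_nonpos_neg)
    from ab(2)[OF this] show False
      using neg by simp
  qed
  then show ?thesis
    using that[of a] ab(1) b by (auto simp: dual_cone_def)
qed

text \<open>By separation, the distance from \<open>w\<close> to the dual cone is at most the largest violation
  of \<open>w \<bullet> x \<ge> 0\<close> on the unit ball of \<open>K\<close>.\<close>

lemma dist_dual_cone_le:
  fixes N :: "'a::euclidean_space \<Rightarrow> real"
  assumes "is_norm N" "closed K" "convex_cone K" "0 \<le> r"
    and w: "\<And>x. x \<in> K \<Longrightarrow> N x \<le> 1 \<Longrightarrow> - r \<le> w \<bullet> x"
  obtains u where "u \<in> dual_cone K" "dual_norm N (u - w) \<le> r"
proof (rule ccontr)
  let ?B = "{u. dual_norm N (u - w) \<le> r}"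
  note dn = is_norm_dual_norm[OF assms(1)]
  assume "\<not> thesis"
  then have disj: "?B \<inter> dual_cone K = {}"
    using that by auto
  have "w \<in> ?B"
    using assms(4) is_norm_0[OF dn] by simp
  \<comment> \<open>The separator \<open>z\<close> of the dual ball from the dual cone is
    nonnegative on the dual cone, hence lies in \<open>K\<close> by the bipolar argument; it is the
    vector that will violate the bound on \<open>w\<close>.\<close>
  then obtain z b where zb: "\<And>u. u \<in> ?B \<Longrightarrow> z \<bullet> u < b" "\<And>u. u \<in> dual_cone K \<Longrightarrow> b < z \<bullet> u"
    using separating_hyperplane_compact_closed[OF is_norm_ball_convex[OF dn] is_norm_ball_compact[OF dn]
        _ _ closed_dual_cone disj] convex_cone_dual_cone[of K]
    unfolding convex_cone_def by blast
  have b: "b < 0"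
    using zb(2)[OF convex_cone_contains_0[OF convex_cone_dual_cone]] by simp
  have "z \<in> K"
  proof (rule ccontr)
    assume "z \<notin> K"
    then obtain u where u: "u \<in> dual_cone K" "u \<bullet> z < 0"
      using separating_dual_cone assms by blast
    then have "(b / (u \<bullet> z)) *\<^sub>R u \<in> dual_cone K"
      using b by (intro convex_cone_scaleR[OF convex_cone_dual_cone]) (auto simp: divide_nonpos_neg)
    from zb(2)[OF this] show False
      using u by (simp add: inner_commute)
  qed
  have "z \<noteq> 0"
    using zb(1)[OF \<open>w \<in> ?B\<close>] b by auto
  then obtain g where g: "dual_norm N g \<le> 1" "g \<bullet> z = N z"
    using norming_functional[OF assms(1)] by blast
  \<comment> \<open>This point maximizes \<open>z\<close> over the ball, so separation there gives
    \<open>w \<bullet> z < - r * N z\<close>, contradicting \<open>w\<close> at the normalized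
    \<open>z\<close>.\<close>
  have "w + r *\<^sub>R g \<in> ?B"
    using g(1) assms(4) by (simp add: is_norm_scaleR[OF dn] mult_left_le)
  from zb(1)[OF this] have "z \<bullet> w + r * N z < 0"
    using g(2) b by (simp add: inner_add_right inner_commute)
  moreover have "- r \<le> w \<bullet> (inverse (N z) *\<^sub>R z)"
    using \<open>z \<in> K\<close> is_norm_nonneg[OF assms(1)] is_norm_normalize[OF assms(1) \<open>z \<noteq> 0\<close>]
    by (intro w convex_cone_scaleR[OF assms(3)]) auto
  then have "- r * N z \<le> w \<bullet> z"
    using is_norm_pos[OF assms(1) \<open>z \<noteq> 0\<close>] by (simp add: field_simps)
  ultimately show False
    by (simp add: inner_commute)
qed

section \<open>Upper bounds on \<open>nu\<close> from explicit pairs\<close>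

lemma nu_le:
  fixes N :: "'a::euclidean_space \<Rightarrow> real"
  assumes "is_norm N" "u \<in> dual_cone K" "u \<noteq> 0" "y \<in> L\<^sup>\<bottom>"
  shows "nu N K L \<le> dual_norm N (u - y) / dual_norm N u"
proof -
  note dn = is_norm_dual_norm[OF assms(1)]
  \<comment> \<open>Scaling \<open>u\<close> and \<open>y\<close> together puts \<open>u\<close> on
    the dual unit sphere and keeps \<open>y\<close> orthogonal to \<open>L\<close>.\<close>
  define c where "c = inverse (dual_norm N u)"
  have c: "0 \<le> c"
    using is_norm_nonneg[OF dn] by (simp add: c_def)
  have "nu N K L \<le> dual_norm N (c *\<^sub>R u - c *\<^sub>R y)"
  proof -
    have "(c *\<^sub>R u, c *\<^sub>R y) \<in> {u \<in> dual_cone K. dual_norm N u = 1} \<times> (L\<^sup>\<bottom>)"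
      using assms(2,4) c is_norm_normalize[OF dn assms(3)]
      by (auto simp: c_def intro: convex_cone_scaleR[OF convex_cone_dual_cone]
          subspace_scale[OF subspace_orthogonal_comp])
    moreover have "bdd_below ((\<lambda>(u, y). dual_norm N (u - y)) ` ({u \<in> dual_cone K. dual_norm N u = 1} \<times> (L\<^sup>\<bottom>)))"
      by (rule bdd_belowI2[where m = 0]) (auto intro: is_norm_nonneg[OF dn])
    ultimately show ?thesis
      unfolding nu_def by (metis (mono_tags, lifting) cINF_lower case_prod_conv)
  qed
  also have "\<dots> = c * dual_norm N (u - y)"
    using c is_norm_scaleR[OF dn, of c "u - y"] by (simp add: scaleR_right_diff_distrib)
  finally show ?thesis
    by (simp add: c_def field_simps)
qed

text \<open>Fixing one \<open>v\<close> and one failing \<open>t\<close> keeps the extrema in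
  \<open>Sym\<close> out of the separation argument.\<close>

lemma nu_le_of_not_mem:
  fixes N :: "'a::euclidean_space \<Rightarrow> real"
  assumes "is_norm N" "closed K" "convex_cone K" "subspace L"
    and v: "v \<in> K" "N v \<le> 1" and t: "0 \<le> t" "t < 1"
    and disj: "\<And>x. x \<in> K \<Longrightarrow> N x \<le> 1 \<Longrightarrow> x + t *\<^sub>R v \<notin> L"
  shows "nu N K L \<le> t / (1 - t)"
proof -
  note dn = is_norm_dual_norm[OF assms(1)]
  define C where "C = (+) (t *\<^sub>R v) ` (K \<inter> {x. N (x - 0) \<le> 1})"
  have "convex (K \<inter> {x. N (x - 0) \<le> 1})"
    using assms(3) by (intro convex_Int is_norm_ball_convex assms(1)) (simp add: convex_cone_def)
  then have "convex C"
    unfolding C_def by (rule convex_translation)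
  moreover have "compact C"
    unfolding C_def
    by (intro compact_translation closed_Int_compact assms(2) is_norm_ball_compact assms(1))
  moreover have "L \<inter> C = {}"
    using disj by (auto simp: C_def add.commute)
  moreover have C0: "t *\<^sub>R v \<in> C"
    using convex_cone_contains_0[OF assms(3)] is_norm_0[OF assms(1)]
    by (auto simp: C_def intro!: rev_image_eqI[of 0])
  ultimately obtain w b where w: "\<And>x. x \<in> L \<Longrightarrow> w \<bullet> x < b" "\<And>x. x \<in> C \<Longrightarrow> b < w \<bullet> x"
    using separating_hyperplane_closed_compact[of L C] closed_subspace[OF assms(4)]
      subspace_imp_convex[OF assms(4)] by blast
  have b: "0 < b"
    using w(1)[OF subspace_0[OF assms(4)]] by simp
  \<comment> \<open>A linear functional bounded above on a subspace vanishes there: otherwise a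
    multiple of \<open>x\<close> attains \<open>b\<close>.\<close>
  have "w \<bullet> x = 0" if "x \<in> L" for x
  proof (rule ccontr)
    assume "w \<bullet> x \<noteq> 0"
    with w(1)[OF subspace_scale[OF assms(4) that, of "b / (w \<bullet> x)"]] show False
      by simp
  qed
  then have wL: "w \<in> L\<^sup>\<bottom>"
    by (auto simp: orthogonal_comp_def orthogonal_def inner_commute)
  have wx: "- (t * (w \<bullet> v)) \<le> w \<bullet> x" if "x \<in> K" "N x \<le> 1" for x
    using w(2)[of "t *\<^sub>R v + x"] b that by (auto simp: C_def inner_add_right)
  have twv: "0 < t * (w \<bullet> v)"
    using w(2)[OF C0] b by simp
  then have wv: "0 < w \<bullet> v"
    using t(1) by (simp add: zero_less_mult_iff)
  obtain u where u: "u \<in> dual_cone K" "dual_norm N (u - w) \<le> t * (w \<bullet> v)"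
    using dist_dual_cone_le[OF assms(1-3) less_imp_le[OF twv] wx] by blast
  have "dual_norm N z * N v \<le> dual_norm N z" for z
    using v(2) is_norm_nonneg[OF dn] by (simp add: mult_left_le)
  then have le: "z \<bullet> v \<le> dual_norm N z" for z
    using inner_le_dual_norm[OF assms(1), of z v] order_trans by blast
  \<comment> \<open>Replacing \<open>w\<close> by \<open>u\<close> costs at most
    \<open>t * (w \<bullet> v)\<close> at \<open>v\<close>; this bounds the normalizing factor of
    \<open>u\<close> from below.\<close>
  have "(1 - t) * (w \<bullet> v) \<le> u \<bullet> v"
    using le[of "w - u"] u(2) is_norm_minus[OF dn, of "u - w"]
    by (simp add: inner_diff_left algebra_simps)
  also have "\<dots> \<le> dual_norm N u"
    by (rule le)
  finally have ge: "(1 - t) * (w \<bullet> v) \<le> dual_norm N u" .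
  have pos: "0 < (1 - t) * (w \<bullet> v)"
    using wv t by simp
  then have "u \<noteq> 0"
    using ge is_norm_eq_0_iff[OF dn, of u] by auto
  then have "nu N K L \<le> dual_norm N (u - w) / dual_norm N u"
    by (intro nu_le assms(1) u(1) wL)
  also have "\<dots> \<le> (t * (w \<bullet> v)) / ((1 - t) * (w \<bullet> v))"
    using ge pos u(2) twv is_norm_nonneg[OF dn] by (intro frac_le) auto
  also have "\<dots> = t / (1 - t)"
    using wv by simp
  finally show ?thesis .
qed

section \<open>The range of \<open>Sym\<close>\<close>

lemma Sym_nonneg:
  assumes "is_norm N" "convex_cone K" "subspace L"
  shows "0 \<le> Sym N L K"
  unfolding Sym_def
proof (rule INF_greatest)
  fix v
  have "0 \<in> {t. 0 \<le> t \<and> (\<exists>x\<in>K. N x \<le> 1 \<and> x + t *\<^sub>R v \<in> L)}"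
    using convex_cone_contains_0[OF assms(2)] is_norm_0[OF assms(1)] subspace_0[OF assms(3)]
    by (auto intro!: bexI[of _ 0])
  then show "0 \<le> (SUP t\<in>{t. 0 \<le> t \<and> (\<exists>x\<in>K. N x \<le> 1 \<and> x + t *\<^sub>R v \<in> L)}. ereal t)"
    by (metis (mono_tags, lifting) SUP_upper zero_ereal_def)
qed

text \<open>For the whole space every nonnegative \<open>t\<close> is admissible. With
  \<open>Sym_le_1\<close> this shows that the only values not below 1 are 1 and infinity, the two
  special cases of \<open>sym_upper\<close>.\<close>

lemma Sym_UNIV:
  assumes "is_norm N" "convex_cone K"
  shows "Sym N UNIV K = \<infinity>"
proof -
  have "{t. 0 \<le> t \<and> (\<exists>x\<in>K. N x \<le> 1 \<and> x + t *\<^sub>R v \<in> UNIV)} = {0..}" for v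
    using convex_cone_contains_0[OF assms(2)] is_norm_0[OF assms(1)] by force
  moreover have "(SUP t\<in>{0::real..}. ereal t) = \<infinity>"
  proof (rule SUP_PInfty)
    show "\<exists>t\<in>{0::real..}. ereal (real n) \<le> ereal t" for n
      by (intro bexI[of _ "real n"]) auto
  qed
  moreover have "{v \<in> K. N v \<le> 1} \<noteq> {}"
    using convex_cone_contains_0[OF assms(2)] is_norm_0[OF assms(1)] by force
  ultimately show ?thesis
    unfolding Sym_def by simp
qed

text \<open>If \<open>y \<bottom> L\<close> and \<open>v\<close> maximizes \<open>\<bar>y \<bullet> v\<bar>\<close> on the unit ball of \<open>K\<close>, then \<open>x + t v \<in> L\<close> forces
  \<open>t \<bar>y \<bullet> v\<bar> = \<bar>y \<bullet> x\<bar> \<le> \<bar>y \<bullet> v\<bar>\<close>.\<close>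

lemma Sym_le_1:
  fixes N :: "'a::euclidean_space \<Rightarrow> real"
  assumes "is_norm N" "closed K" "convex_cone K" "interior K \<noteq> {}" "subspace L" "L \<noteq> UNIV"
  shows "Sym N L K \<le> 1"
proof -
  let ?C = "K \<inter> {x. N (x - 0) \<le> 1}"
  have "L\<^sup>\<bottom> \<noteq> {0}"
    using orthogonal_comp_self[OF assms(5)] assms(6) by auto
  then obtain y where y: "y \<in> L\<^sup>\<bottom>" "y \<noteq> 0"
    using subspace_0[OF subspace_orthogonal_comp[of L]] by blast
  have "compact ?C"
    by (intro closed_Int_compact assms(2) is_norm_ball_compact assms(1))
  moreover have "0 \<in> ?C"
    using convex_cone_contains_0[OF assms(3)] is_norm_0[OF assms(1)] by simp
  moreover have "continuous_on ?C (\<lambda>x. \<bar>y \<bullet> x\<bar>)"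
    by (intro continuous_intros)
  ultimately obtain v where v: "v \<in> ?C" "\<And>x. x \<in> ?C \<Longrightarrow> \<bar>y \<bullet> x\<bar> \<le> \<bar>y \<bullet> v\<bar>"
    using continuous_attains_sup[of ?C "\<lambda>x. \<bar>y \<bullet> x\<bar>"] by blast
  \<comment> \<open>Otherwise \<open>y\<close> would vanish on all of \<open>K\<close>, placing its
    nonempty interior inside a hyperplane.\<close>
  have "y \<bullet> v \<noteq> 0"
  proof
    assume "y \<bullet> v = 0"
    have "y \<bullet> x = 0" if "x \<in> K" for x
    proof (cases "x = 0")
      case False
      have "inverse (N x) *\<^sub>R x \<in> ?C"
        using that is_norm_nonneg[OF assms(1), of x] is_norm_normalize[OF assms(1) False]
        by (auto intro: convex_cone_scaleR[OF assms(3)])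
      then show ?thesis
        using v(2) \<open>y \<bullet> v = 0\<close> is_norm_pos[OF assms(1) False] by fastforce
    qed simp
    then have "interior K \<subseteq> interior {x. y \<bullet> x = 0}"
      by (intro interior_mono) auto
    then show False
      using assms(4) y(2) by simp
  qed
  have "(SUP t\<in>{t. 0 \<le> t \<and> (\<exists>x\<in>K. N x \<le> 1 \<and> x + t *\<^sub>R v \<in> L)}. ereal t) \<le> 1"
  proof (rule SUP_least)
    fix t assume "t \<in> {t. 0 \<le> t \<and> (\<exists>x\<in>K. N x \<le> 1 \<and> x + t *\<^sub>R v \<in> L)}"
    then obtain x where x: "0 \<le> t" "x \<in> ?C" "x + t *\<^sub>R v \<in> L"
      by auto
    then have "y \<bullet> x + t * (y \<bullet> v) = 0"
      using y(1) by (auto simp: orthogonal_comp_def orthogonal_def inner_commute inner_add_right)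
    then have "t * \<bar>y \<bullet> v\<bar> = \<bar>y \<bullet> x\<bar>"
      using x(1) by (metis abs_minus_cancel abs_mult abs_of_nonneg eq_neg_iff_add_eq_0)
    also have "\<dots> \<le> 1 * \<bar>y \<bullet> v\<bar>"
      using v(2)[OF x(2)] by simp
    finally show "ereal t \<le> 1"
      using \<open>y \<bullet> v \<noteq> 0\<close> by (simp add: one_ereal_def)
  qed
  then show ?thesis
    unfolding Sym_def using v(1) by (intro INF_lower2[of v]) auto
qed

section \<open>The two bounds on \<open>nu\<close>\<close>

lemma dual_norm_unit_dual_cone_nonempty:
  fixes N :: "'a::euclidean_space \<Rightarrow> real"
  assumes "is_norm N" "closed K" "convex_cone K" "K \<noteq> UNIV"
  shows "{u \<in> dual_cone K. dual_norm N u = 1} \<noteq> {}"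
proof -
  obtain z where "z \<notin> K"
    using assms(4) by blast
  then obtain u where u: "u \<in> dual_cone K" "u \<bullet> z < 0"
    using separating_dual_cone assms(2,3) by blast
  note dn = is_norm_dual_norm[OF assms(1)]
  have "u \<noteq> 0"
    using u(2) by auto
  then have "inverse (dual_norm N u) *\<^sub>R u \<in> {u \<in> dual_cone K. dual_norm N u = 1}"
    using u(1) is_norm_nonneg[OF dn] is_norm_normalize[OF dn]
    by (auto intro: convex_cone_scaleR[OF convex_cone_dual_cone])
  then show ?thesis
    by blast
qed

lemma nu_nonneg:
  fixes N :: "'a::euclidean_space \<Rightarrow> real"
  assumes "is_norm N" "closed K" "convex_cone K" "K \<noteq> UNIV"
  shows "0 \<le> nu N K L"
proof -
  \<comment> \<open>The infimum of an empty set of reals has no useful value, so nonemptiness comes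
    first.\<close>
  have "{u \<in> dual_cone K. dual_norm N u = 1} \<times> (L\<^sup>\<bottom>) \<noteq> {}"
    using dual_norm_unit_dual_cone_nonempty[OF assms] subspace_0[OF subspace_orthogonal_comp[of L]] by blast
  then show ?thesis
    unfolding nu_def by (rule cINF_greatest) (auto intro: dual_norm_nonneg[OF assms(1)])
qed

text \<open>For each \<open>t\<close> strictly between \<open>Sym\<close> and 1 some
  \<open>v\<close> admits no \<open>x\<close>, so \<open>nu_le_of_not_mem\<close> applies; then
  \<open>t\<close> decreases to \<open>Sym\<close>. When \<open>Sym\<close> is not below 1, the
  right-hand side is infinite.\<close>

lemma nu_upper:
  fixes N :: "'a::euclidean_space \<Rightarrow> real"
  assumes "is_norm N" "closed K" "convex_cone K" "K \<noteq> UNIV" "interior K \<noteq> {}" "subspace L"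
  shows "ereal (nu N K L) \<le> sym_upper (Sym N L K)"
proof (cases "Sym N L K < 1")
  case True
  then obtain s where s: "Sym N L K = ereal s" "0 \<le> s" "s < 1"
    using Sym_nonneg[OF assms(1,3,6)] by (cases "Sym N L K") auto
  have nonneg: "0 \<le> nu N K L"
    by (rule nu_nonneg[OF assms(1-4)])
  \<comment> \<open>Solving the bound \<open>t / (1 - t)\<close> for \<open>t\<close> turns the
    limit into a density argument.\<close>
  have "nu N K L / (1 + nu N K L) \<le> s"
  proof (rule dense_ge_bounded[OF s(3)])
    fix t assume t: "s < t" "t < 1"
    then have "Sym N L K < ereal t"
      by (simp add: s)
    then obtain v where v: "v \<in> K" "N v \<le> 1"
      and less: "(SUP t\<in>{t. 0 \<le> t \<and> (\<exists>x\<in>K. N x \<le> 1 \<and> x + t *\<^sub>R v \<in> L)}. ereal t) < ereal t"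
      unfolding Sym_def INF_less_iff by auto
    have "x + t *\<^sub>R v \<notin> L" if "x \<in> K" "N x \<le> 1" for x
    proof
      assume "x + t *\<^sub>R v \<in> L"
      then have "t \<in> {t. 0 \<le> t \<and> (\<exists>x\<in>K. N x \<le> 1 \<and> x + t *\<^sub>R v \<in> L)}"
        using that s t by auto
      from SUP_upper[OF this, of ereal] less show False
        by simp
    qed
    then have "nu N K L \<le> t / (1 - t)"
      using v s t by (intro nu_le_of_not_mem[OF assms(1-3,6)]) auto
    then show "nu N K L / (1 + nu N K L) \<le> t"
      using nonneg t by (simp add: field_simps)
  qed
  then have "nu N K L \<le> s / (1 - s)"
    using nonneg s by (simp add: field_simps)
  moreover have "sym_upper (Sym N L K) = ereal (s / (1 - s))"
    using s by (simp add: sym_upper_def one_ereal_def)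
  ultimately show ?thesis
    by simp
next
  case False
  have "Sym N L K = 1 \<or> Sym N L K = \<infinity>"
    using Sym_le_1[OF assms(1-3,5,6)] Sym_UNIV[OF assms(1,3)] False by (cases "L = UNIV") auto
  then show ?thesis
    by (simp add: sym_upper_def)
qed

text \<open>The min-max constant enters only through a lower bound \<open>\<mu>\<close> that every
  unit \<open>u\<close> reaches on the unit sphere of \<open>K\<close>; it then suffices to bound
  the distance for every pair \<open>u\<close>, \<open>y\<close>.\<close>

lemma nu_lower:
  fixes N :: "'a::euclidean_space \<Rightarrow> real"
  assumes "is_norm N" "closed K" "convex_cone K" "K \<noteq> UNIV" "subspace L" "0 \<le> \<mu>"
    and \<mu>: "\<And>u. u \<in> dual_cone K \<Longrightarrow> dual_norm N u = 1 \<Longrightarrow> \<exists>v\<in>K. N v = 1 \<and> \<mu> \<le> u \<bullet> v"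
  shows "ereal \<mu> * sym_lower (Sym N L K) \<le> ereal (nu N K L)"
proof -
  \<comment> \<open>The real value of \<open>sym_lower\<close>, which keeps the infimum argument in
    the reals.\<close>
  define q where "q = (if Sym N L K = \<infinity> then 1 else real_of_ereal (Sym N L K) / (1 + real_of_ereal (Sym N L K)))"
  have nonneg: "0 \<le> Sym N L K"
    by (rule Sym_nonneg[OF assms(1,3,5)])
  have q: "sym_lower (Sym N L K) = ereal q" "q \<le> 1"
    using nonneg by (cases "Sym N L K"; simp add: sym_lower_def q_def one_ereal_def)+
  have "\<mu> * q \<le> dual_norm N (u - y)"
    if u: "u \<in> dual_cone K" "dual_norm N u = 1" and y: "y \<in> L\<^sup>\<bottom>" for u y
  \<comment> \<open>If the distance already reaches \<open>\<mu>\<close>, then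
    \<open>q \<le> 1\<close> suffices; otherwise \<open>\<mu> - \<delta>\<close> is positive and may
    be divided by.\<close>
  proof (cases "\<mu> \<le> dual_norm N (u - y)")
    case True
    then show ?thesis
      using mult_left_le[OF q(2) assms(6)] by simp
  next
    case False
    define \<delta> where "\<delta> = dual_norm N (u - y)"
    have \<delta>: "0 \<le> \<delta>" "\<delta> < \<mu>"
      using False dual_norm_nonneg[OF assms(1)] by (auto simp: \<delta>_def)
    obtain v where v: "v \<in> K" "N v = 1" "\<mu> \<le> u \<bullet> v"
      using \<mu>[OF u] by blast
    have "(SUP t\<in>{t. 0 \<le> t \<and> (\<exists>x\<in>K. N x \<le> 1 \<and> x + t *\<^sub>R v \<in> L)}. ereal t) \<le> ereal (\<delta> / (\<mu> - \<delta>))"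
    proof (rule SUP_least)
      fix t assume "t \<in> {t. 0 \<le> t \<and> (\<exists>x\<in>K. N x \<le> 1 \<and> x + t *\<^sub>R v \<in> L)}"
      then obtain x where t: "0 \<le> t" and x: "x \<in> K" "N x \<le> 1" "x + t *\<^sub>R v \<in> L"
        by auto
      have "y \<bullet> (x + t *\<^sub>R v) = 0"
        using y x(3) by (auto simp: orthogonal_comp_def orthogonal_def inner_commute)
      have "\<mu> * t \<le> u \<bullet> x + t * (u \<bullet> v)"
        using u(1) x(1) mult_right_mono[OF v(3) t] by (auto simp: dual_cone_def mult.commute add_increasing)
      also have "\<dots> = (u - y) \<bullet> (x + t *\<^sub>R v)"
        using \<open>y \<bullet> (x + t *\<^sub>R v) = 0\<close> by (simp add: inner_diff_left inner_add_right algebra_simps)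
      also have "\<dots> \<le> \<delta> * N (x + t *\<^sub>R v)"
        unfolding \<delta>_def by (rule inner_le_dual_norm[OF assms(1)])
      also have "\<dots> \<le> \<delta> * (1 + t)"
        using is_norm_triangle[OF assms(1), of x "t *\<^sub>R v"] x(2) v(2) t \<delta>(1)
        by (intro mult_left_mono) (auto simp: is_norm_scaleR[OF assms(1)])
      finally show "ereal t \<le> ereal (\<delta> / (\<mu> - \<delta>))"
        using \<delta> by (simp add: field_simps)
    qed
    then have "Sym N L K \<le> ereal (\<delta> / (\<mu> - \<delta>))"
      unfolding Sym_def using v by (intro INF_lower2[of v]) auto
    \<comment> \<open>The bound excludes the infinite branch of \<open>q\<close>.\<close>
    then obtain s where s: "Sym N L K = ereal s" "0 \<le> s" "s \<le> \<delta> / (\<mu> - \<delta>)"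
      using nonneg by (cases "Sym N L K") auto
    then have "\<mu> * s \<le> \<delta> * (1 + s)"
      using \<delta> by (simp add: field_simps)
    then show ?thesis
      using s by (simp add: q_def \<delta>_def[symmetric] field_simps)
  qed
  moreover have "{u \<in> dual_cone K. dual_norm N u = 1} \<times> (L\<^sup>\<bottom>) \<noteq> {}"
    using dual_norm_unit_dual_cone_nonempty[OF assms(1-4)] subspace_0[OF subspace_orthogonal_comp[of L]] by blast
  ultimately have "\<mu> * q \<le> nu N K L"
    unfolding nu_def by (intro cINF_greatest) auto
  then show ?thesis
    using q(1) by simp
qed

section \<open>The min-max constant and Euclidean angles\<close>

lemma SUP_inner_attained:
  fixes N :: "'a::euclidean_space \<Rightarrow> real"
  assumes "is_norm N" "closed K" "convex_cone K" "z \<in> K" "z \<noteq> 0"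
  obtains v where "v \<in> K" "N v = 1" "(SUP v\<in>{v \<in> K. N v = 1}. u \<bullet> v) = u \<bullet> v"
    "\<forall>x\<in>K. N x = 1 \<longrightarrow> u \<bullet> x \<le> u \<bullet> v"
proof -
  let ?S = "{v \<in> K. N v = 1}"
  have "?S = (K \<inter> {x. 1 \<le> N x}) \<inter> {x. N (x - 0) \<le> 1}"
    by auto
  moreover have "closed {x. 1 \<le> N x}"
    by (intro closed_Collect_le continuous_intros is_norm_continuous_on assms(1))
  ultimately have "compact ?S"
    using assms(2) by (simp only: closed_Int_compact closed_Int is_norm_ball_compact[OF assms(1)])
  moreover have "inverse (N z) *\<^sub>R z \<in> ?S"
    using assms(4,5) is_norm_nonneg[OF assms(1)] is_norm_normalize[OF assms(1)]
    by (auto intro: convex_cone_scaleR[OF assms(3)])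
  moreover have "continuous_on ?S (\<lambda>x. u \<bullet> x)"
    by (intro continuous_intros)
  ultimately obtain v where v: "v \<in> ?S" "\<And>x. x \<in> ?S \<Longrightarrow> u \<bullet> x \<le> u \<bullet> v"
    using continuous_attains_sup[of ?S "\<lambda>x. u \<bullet> x"] by blast
  have "(SUP v\<in>?S. u \<bullet> v) = u \<bullet> v"
    by (rule cSup_eq_maximum) (use v in auto)
  with v show ?thesis
    using that by auto
qed

lemma min_max_inner_nonneg:
  fixes N :: "'a::euclidean_space \<Rightarrow> real"
  assumes "is_norm N" "closed K" "convex_cone K" "K \<noteq> UNIV" "z \<in> K" "z \<noteq> 0"
  shows "0 \<le> min_max_inner N K"
  unfolding min_max_inner_def
proof (rule cINF_greatest[OF dual_norm_unit_dual_cone_nonempty[OF assms(1-4)]])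
  fix u assume u: "u \<in> {u \<in> dual_cone K. dual_norm N u = 1}"
  obtain v where "v \<in> K" "(SUP v\<in>{v \<in> K. N v = 1}. u \<bullet> v) = u \<bullet> v"
    using SUP_inner_attained[OF assms(1-3,5,6), of u] by blast
  with u show "0 \<le> (SUP v\<in>{v \<in> K. N v = 1}. u \<bullet> v)"
    by (simp add: dual_cone_def)
qed

text \<open>This supplies the hypothesis of \<open>nu_lower\<close>: each inner supremum is
  attained, and all are nonnegative, so the outer infimum is a true lower bound.\<close>

lemma min_max_inner_le:
  fixes N :: "'a::euclidean_space \<Rightarrow> real"
  assumes "is_norm N" "closed K" "convex_cone K" "z \<in> K" "z \<noteq> 0"
    and u: "u \<in> dual_cone K" "dual_norm N u = 1"
  shows "\<exists>v\<in>K. N v = 1 \<and> min_max_inner N K \<le> u \<bullet> v"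
proof -
  have "0 \<le> (SUP v\<in>{v \<in> K. N v = 1}. u \<bullet> v)" if "u \<in> dual_cone K" for u
  proof -
    obtain v where "v \<in> K" "(SUP v\<in>{v \<in> K. N v = 1}. u \<bullet> v) = u \<bullet> v"
      using SUP_inner_attained[OF assms(1-5), of u] by blast
    with that show ?thesis
      by (simp add: dual_cone_def)
  qed
  then have "bdd_below ((\<lambda>u. SUP v\<in>{v \<in> K. N v = 1}. u \<bullet> v) ` {u \<in> dual_cone K. dual_norm N u = 1})"
    by (intro bdd_belowI2[where m = 0]) auto
  then have le: "min_max_inner N K \<le> (SUP v\<in>{v \<in> K. N v = 1}. u \<bullet> v)"
    unfolding min_max_inner_def using u by (intro cINF_lower) auto
  obtain v where "v \<in> K" "N v = 1" "(SUP v\<in>{v \<in> K. N v = 1}. u \<bullet> v) = u \<bullet> v"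
    using SUP_inner_attained[OF assms(1-5), of u] by blast
  with le show ?thesis
    by auto
qed

text \<open>For a unit \<open>u\<close> the angle to \<open>K\<close> is smallest where the inner
  product is largest, and the cosine decreases on \<open>[0, pi]\<close>.\<close>

lemma cos_Theta_le_min_max_inner:
  fixes K :: "'a::euclidean_space set"
  assumes "closed K" "convex_cone K" "K \<noteq> UNIV" "z \<in> K" "z \<noteq> 0"
  shows "cos (Theta (dual_cone K) K) \<le> min_max_inner norm K"
  unfolding min_max_inner_def
proof (rule cINF_greatest[OF dual_norm_unit_dual_cone_nonempty[OF is_norm_norm assms(1-3)]])
  fix u assume "u \<in> {u \<in> dual_cone K. dual_norm norm u = 1}"
  then have u: "u \<in> dual_cone K" "norm u = 1"
    by (auto simp: dual_norm_norm)
  obtain v where v: "v \<in> K" "norm v = 1" "(SUP v\<in>{v \<in> K. norm v = 1}. u \<bullet> v) = u \<bullet> v"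
    "\<forall>x\<in>K. norm x = 1 \<longrightarrow> u \<bullet> x \<le> u \<bullet> v"
    using SUP_inner_attained[OF is_norm_norm assms(1,2,4,5), of u] by blast
  have ne: "K - {0} \<noteq> {}"
    using assms(4,5) by blast
  have "\<bar>a \<bullet> b / (norm a * norm b)\<bar> \<le> 1" for a b :: 'a
    using Cauchy_Schwarz_ineq2[of a b] by (cases "a = 0 \<or> b = 0") (auto simp: field_simps abs_mult)
  then have arg: "- 1 \<le> a \<bullet> b / (norm a * norm b)" "a \<bullet> b / (norm a * norm b) \<le> 1" for a b :: 'a
    unfolding abs_le_iff using minus_le_iff by blast+
  have angle: "0 \<le> vec_angle a b" "vec_angle a b \<le> pi" for a b :: 'a
    unfolding vec_angle_def by (intro arccos_lbound arccos_ubound arg)+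
  \<comment> \<open>The bounds 0 and \<open>pi\<close> on angles make the real infimum and supremum
    in \<open>Theta\<close> genuine.\<close>
  have bdd: "bdd_below (vec_angle a ` (K - {0}))" for a
    by (rule bdd_belowI2[where m = 0]) (rule angle)
  have INF_le: "(INF v\<in>K - {0}. vec_angle a v) \<le> pi" for a
    using assms(4,5) angle(2) by (intro cINF_lower2[OF bdd, of z]) auto
  have uv: "\<bar>u \<bullet> v\<bar> \<le> 1"
    using Cauchy_Schwarz_ineq2[of u v] u v by simp
  have "arccos (u \<bullet> v) \<le> (INF v\<in>K - {0}. vec_angle u v)"
  proof (rule cINF_greatest[OF ne])
    fix x assume x: "x \<in> K - {0}"
    then have "u \<bullet> (inverse (norm x) *\<^sub>R x) \<le> u \<bullet> v"
      by (intro v(4)[rule_format] convex_cone_scaleR[OF assms(2)]) auto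
    then have "u \<bullet> x / (norm u * norm x) \<le> u \<bullet> v"
      using u(2) by (simp add: field_simps)
    then show "arccos (u \<bullet> v) \<le> vec_angle u x"
      unfolding vec_angle_def using uv by (intro arccos_le_arccos arg) auto
  qed
  also have "\<dots> \<le> Theta (dual_cone K) K"
    unfolding Theta_def using u INF_le by (intro cSUP_upper bdd_aboveI2[where M = pi]) auto
  finally have "cos (Theta (dual_cone K) K) \<le> cos (arccos (u \<bullet> v))"
  proof (rule cos_monotone_0_pi_le[rotated])
    show "Theta (dual_cone K) K \<le> pi"
      unfolding Theta_def using u INF_le by (intro cSUP_least) auto
    show "0 \<le> arccos (u \<bullet> v)"
      using uv by (intro arccos_lbound) auto
  qed
  also have "\<dots> = u \<bullet> v"
    using uv by (intro cos_arccos) auto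
  finally show "cos (Theta (dual_cone K) K) \<le> (SUP v\<in>{v \<in> K. norm v = 1}. u \<bullet> v)"
    using v(3) by simp
qed

theorem corollary1:
  fixes N :: "'a::euclidean_space \<Rightarrow> real" and K L :: "'a set"
  assumes "is_norm N"
    and "regular_closed_convex_cone K"
    and "subspace L"
    and "L \<inter> interior K \<noteq> {}"
  shows "ereal (min_max_inner N K) * sym_lower (Sym N L K) \<le> ereal (nu N K L) \<and>
         ereal (nu N K L) \<le> sym_upper (Sym N L K) \<and>
         (N = norm \<longrightarrow>
            ereal (cos (Theta (dual_cone K) K)) * sym_lower (Sym N L K) \<le> ereal (nu N K L) \<and>
            ereal (nu N K L) \<le> sym_upper (Sym N L K))"
proof -
  have K: "closed K" "convex_cone K" "interior K \<noteq> {}"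
    and no_line: "\<not> (\<exists>x d. d \<noteq> 0 \<and> (\<forall>t::real. x + t *\<^sub>R d \<in> K))"
    using assms(2) by (auto simp: regular_closed_convex_cone_def)
  \<comment> \<open>The whole space has positive dimension and so contains a line.\<close>
  have "K \<noteq> UNIV"
    using no_line nonzero_Basis nonempty_Basis by blast
  have "\<not> K \<subseteq> {0}"
    using K(3) interior_mono[of K "{0}"] by auto
  then obtain z where z: "z \<in> K" "z \<noteq> 0"
    by blast
  have upper: "ereal (nu N K L) \<le> sym_upper (Sym N L K)"
    by (rule nu_upper[OF assms(1) K(1,2) \<open>K \<noteq> UNIV\<close> K(3) assms(3)])
  have lower: "ereal (min_max_inner N K) * sym_lower (Sym N L K) \<le> ereal (nu N K L)"
    by (rule nu_lower[OF assms(1) K(1,2) \<open>K \<noteq> UNIV\<close> assms(3)])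
      (use min_max_inner_nonneg[OF assms(1) K(1,2) \<open>K \<noteq> UNIV\<close> z]
        min_max_inner_le[OF assms(1) K(1,2) z] in auto)
  \<comment> \<open>Nonnegativity of this factor allows the comparison of the two constants to be
    multiplied by it.\<close>
  have "0 \<le> sym_lower (Sym N L K)"
    using Sym_nonneg[OF assms(1) K(2) assms(3)]
    by (cases "Sym N L K") (auto simp: sym_lower_def one_ereal_def)
  then have "ereal (cos (Theta (dual_cone K) K)) * sym_lower (Sym N L K)
      \<le> ereal (min_max_inner N K) * sym_lower (Sym N L K)" if "N = norm"
    using cos_Theta_le_min_max_inner[OF K(1,2) \<open>K \<noteq> UNIV\<close> z] that
    by (intro ereal_mult_right_mono) auto
  with upper lower show ?thesis
    using order_trans by blast
qed

end
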